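(* Let $\mathcal A=((A,[\,,\,]_A),(V,\rho),T)$ and $\mathcal B=((B,[\,,\,]_B),(M,\nu_M),S)$ be two relative Rota-Baxter Lie algebras over a field $k$. Let $0\to\mathcal B\xrightarrow{(\mathfrak i,i)}\hat{\mathcal A}\xrightarrow{(\mathfrak p,p)}\mathcal A\to0$ be a non-abelian extension of $\mathcal A$ by $\mathcal B$ with a section $(\mathfrak s,s)$ of $(\mathfrak p,p)$, and let $(\omega,\varpi,\chi,\mu,\rho_B,\rho_M)$ be the corresponding non-abelian 2-cocycle induced by $(\mathfrak s,s)$. A pair $(\alpha,\beta)\in\mathrm{Aut}(\mathcal A)\times\mathrm{Aut}(\mathcal B)$ is inducible if and only if the two non-abelian 2-cocycles $(\omega,\varpi,\chi,\mu,\rho_B,\rho_M)$ and $(\omega_{(\alpha,\beta)},\varpi_{(\alpha,\beta)},\chi_{(\alpha,\beta)},\mu_{(\alpha,\beta)},\rho_{(B,(\alpha,\beta))},\rho_{(M,(\alpha,\beta))})$ are equivalent.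
   Context: A relative Rota-Baxter Lie algebra is a triple $((A,[\,,\,]_A),(V,\rho),T)$ where $(A,[\,,\,]_A)$ is a Lie algebra, $\rho:A\to\mathfrak{gl}(V)$ is a representation of $A$ on the vector space $V$, and $T:V\to A$ is a linear map with $[T(u),T(v)]_A=T(\rho(T(u))v-\rho(T(v))u)$ for all $u,v\in V$. A homomorphism from $((A,[\,,\,]_A),(V,\rho),T)$ to $((A',[\,,\,]_{A'}),(V',\rho'),T')$ is a pair $(\varphi,\phi)$ with $\varphi:A\to A'$ a Lie algebra homomorphism and $\phi:V\to V'$ a linear map such that $T'\phi=\varphi T$ and $\phi(\rho(x)v)=\rho'(\varphi(x))\phi(v)$. $\mathrm{Aut}(\mathcal A)$ is the group of bijective homomorphisms $\mathcal A\to\mathcal A$. A non-abelian extension of $\mathcal A$ by $\mathcal B$ is a relative Rota-Baxter Lie algebra $\hat{\mathcal A}=((\hat A,[\,,\,]_{\hat A}),(\hat V,\hat\rho),\hat T)$ with homomorphisms $(\mathfrak i,i):\mathcal B\to\hat{\mathcal A}$ and $(\mathfrak p,p):\hat{\mathcal A}\to\mathcal A$ such that $0\to B\xrightarrow{\mathfrak i}\hat A\xrightarrow{\mathfrak p}A\to0$ and $0\to M\xrightarrow{i}\hat V\xrightarrow{p}V\to0$ are exact. $B$ and $M$ are identified with their images in $\hat A$ and $\hat V$. A section of $(\mathfrak p,p)$ is a pair of linear maps $\mathfrak s:A\to\hat A$, $s:V\to\hat V$ with $\mathfrak p\mathfrak s=\mathrm{id}_A$, $ps=\mathrm{id}_V$.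 The non-abelian 2-cocycle induced by $(\mathfrak s,s)$ is the sextuple given, for $x,y\in A$, $a\in B$, $v\in V$, $m\in M$, by $\omega(x,y)=[\mathfrak s(x),\mathfrak s(y)]_{\hat A}-\mathfrak s([x,y]_A)\in B$, $\varpi(x,v)=\hat\rho(\mathfrak s(x))s(v)-s(\rho(x)v)\in M$, $\chi(v)=\hat T(s(v))-\mathfrak s(T(v))\in B$, $\mu(v)a=-\hat\rho(a)s(v)\in M$, $\rho_B(x)a=[\mathfrak s(x),a]_{\hat A}\in B$, $\rho_M(x)m=\hat\rho(\mathfrak s(x))m\in M$. For $\alpha=(\alpha_1,\alpha_2)\in\mathrm{Aut}(\mathcal A)$, $\beta=(\beta_1,\beta_2)\in\mathrm{Aut}(\mathcal B)$: $\omega_{(\alpha,\beta)}(x,y)=\beta_1\omega(\alpha_1^{-1}(x),\alpha_1^{-1}(y))$, $\varpi_{(\alpha,\beta)}(x,v)=\beta_2\varpi(\alpha_1^{-1}(x),\alpha_2^{-1}(v))$, $\chi_{(\alpha,\beta)}(v)=\beta_1\chi(\alpha_2^{-1}(v))$, $\mu_{(\alpha,\beta)}(v)a=\beta_2\mu(\alpha_2^{-1}(v))\beta_1^{-1}(a)$, $\rho_{(B,(\alpha,\beta))}(x)a=\beta_1\rho_B(\alpha_1^{-1}(x))\beta_1^{-1}(a)$, $\rho_{(M,(\alpha,\beta))}(x)m=\beta_2\rho_M(\alpha_1^{-1}(x))\beta_2^{-1}(m)$. Two sextuples $(\omega,\varpi,\chi,\mu,\rho_B,\rho_M)$ and $(\omega',\varpi',\chi',\mu',\rho_B',\rho_M')$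 are equivalent if there exist linear maps $\zeta:A\to B$, $\eta:V\to M$ such that for all $x,y\in A$, $a\in B$, $m\in M$, $v\in V$: $\omega(x,y)-\omega'(x,y)=\rho_B'(x)\zeta(y)-\rho_B'(y)\zeta(x)-\zeta([x,y]_A)+[\zeta(x),\zeta(y)]_B$; $\rho_B(x)a-\rho_B'(x)a=[\zeta(x),a]_B$; $\rho_M(x)m-\rho_M'(x)m=\nu_M(\zeta(x))m$; $\mu(v)a-\mu'(v)a=-\nu_M(a)\eta(v)$; $\chi(v)-\chi'(v)=S\eta(v)-\zeta T(v)$; $\varpi(x,v)-\varpi'(x,v)=\rho_M'(x)\eta(v)+\nu_M(\zeta(x))\eta(v)-\mu'(v)\zeta(x)-\eta(\rho(x)v)$. A pair $(\alpha,\beta)\in\mathrm{Aut}(\mathcal A)\times\mathrm{Aut}(\mathcal B)$ is inducible if there is $\gamma=(\gamma_1,\gamma_2)\in\mathrm{Aut}(\hat{\mathcal A})$ with $\gamma_1(B)\subseteq B$, $\gamma_2(M)\subseteq M$, $(\mathfrak p\gamma_1\mathfrak s,p\gamma_2s)=(\alpha_1,\alpha_2)$ and $(\gamma_1|_B,\gamma_2|_M)=(\beta_1,\beta_2)$. *)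

theory Defs
  imports Complex_Main
begin

text \<open>Vector spaces are carried by whole types, as in \<^theory>\<open>HOL.Vector_Spaces\<close>.\<close>

locale lie_algebra = vector_space scale
  for scale :: "'k::field \<Rightarrow> 'a::ab_group_add \<Rightarrow> 'a" +
  fixes bracket :: "'a \<Rightarrow> 'a \<Rightarrow> 'a"
  assumes bracket_linear_left: "Vector_Spaces.linear scale scale (\<lambda>x. bracket x y)"
    and bracket_linear_right: "Vector_Spaces.linear scale scale (\<lambda>y. bracket x y)"
    and bracket_alternating: "bracket x x = 0"
    and jacobi: "bracket x (bracket y z) + bracket y (bracket z x) + bracket z (bracket x y) = 0"

locale lie_representation = L: lie_algebra scaleA bracket + V: vector_space scaleV
  for scaleA :: "'k::field \<Rightarrow> 'a::ab_group_add \<Rightarrow> 'a"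
    and bracket :: "'a \<Rightarrow> 'a \<Rightarrow> 'a"
    and scaleV :: "'k \<Rightarrow> 'v::ab_group_add \<Rightarrow> 'v" +
  fixes action :: "'a \<Rightarrow> 'v \<Rightarrow> 'v"
  assumes action_linear: "Vector_Spaces.linear scaleV scaleV (action x)"
    and action_linear_left: "Vector_Spaces.linear scaleA scaleV (\<lambda>x. action x v)"
    and action_bracket: "action (bracket x y) v = action x (action y v) - action y (action x v)"

record ('k, 'a, 'v) rel_rb =
  scaleA :: "'k \<Rightarrow> 'a \<Rightarrow> 'a"
  brk :: "'a \<Rightarrow> 'a \<Rightarrow> 'a"
  scaleV :: "'k \<Rightarrow> 'v \<Rightarrow> 'v"
  act :: "'a \<Rightarrow> 'v \<Rightarrow> 'v"
  rb_op :: "'v \<Rightarrow> 'a"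

locale rel_rota_baxter_lie_algebra =
  lie_representation "scaleA R" "brk R" "scaleV R" "act R"
  for R :: "('k::field, 'a::ab_group_add, 'v::ab_group_add) rel_rb" +
  assumes rb_op_linear: "Vector_Spaces.linear (scaleV R) (scaleA R) (rb_op R)"
    and rota_baxter: "brk R (rb_op R u) (rb_op R v)
      = rb_op R (act R (rb_op R u) v - act R (rb_op R v) u)"

definition rel_rb_hom ::
  "('k::field, 'a::ab_group_add, 'v::ab_group_add) rel_rb \<Rightarrow>
   ('k, 'c::ab_group_add, 'w::ab_group_add) rel_rb \<Rightarrow> (('a \<Rightarrow> 'c) \<times> ('v \<Rightarrow> 'w)) set" where
  "rel_rb_hom R R' = {(f, g).
     Vector_Spaces.linear (scaleA R) (scaleA R') f \<and>
     (\<forall>x y. f (brk R x y) = brk R' (f x) (f y)) \<and>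
     Vector_Spaces.linear (scaleV R) (scaleV R') g \<and>
     (\<forall>v. rb_op R' (g v) = f (rb_op R v)) \<and>
     (\<forall>x v. g (act R x v) = act R' (f x) (g v))}"

definition rel_rb_Aut ::
  "('k::field, 'a::ab_group_add, 'v::ab_group_add) rel_rb \<Rightarrow> (('a \<Rightarrow> 'a) \<times> ('v \<Rightarrow> 'v)) set" where
  "rel_rb_Aut R = {(f, g). (f, g) \<in> rel_rb_hom R R \<and> bij f \<and> bij g}"

text \<open>\<open>E\<close> is an extension of \<open>A\<close> by \<open>B\<close>. The embeddings \<open>iB\<close> and \<open>iM\<close> are kept explicit:
  the identification of \<open>B\<close> and \<open>M\<close> with subspaces of the total spaces is \<open>range iB\<close>, \<open>range iM\<close>.\<close>

locale non_abelian_extension =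
  A: rel_rota_baxter_lie_algebra A + B: rel_rota_baxter_lie_algebra B +
  E: rel_rota_baxter_lie_algebra E
  for A :: "('k::field, 'a::ab_group_add, 'v::ab_group_add) rel_rb"
    and B :: "('k, 'b::ab_group_add, 'm::ab_group_add) rel_rb"
    and E :: "('k, 'e::ab_group_add, 'w::ab_group_add) rel_rb" +
  fixes iB :: "'b \<Rightarrow> 'e" and iM :: "'m \<Rightarrow> 'w" and pA :: "'e \<Rightarrow> 'a" and pV :: "'w \<Rightarrow> 'v"
  assumes i_hom: "(iB, iM) \<in> rel_rb_hom B E"
    and p_hom: "(pA, pV) \<in> rel_rb_hom E A"
    and inj_iB: "inj iB" and exact_A: "range iB = {x. pA x = 0}" and surj_pA: "surj pA"
    and inj_iM: "inj iM" and exact_V: "range iM = {w. pV w = 0}" and surj_pV: "surj pV"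

definition is_section ::
  "('k::field, 'a::ab_group_add, 'v::ab_group_add) rel_rb \<Rightarrow>
   ('k, 'e::ab_group_add, 'w::ab_group_add) rel_rb \<Rightarrow>
   ('e \<Rightarrow> 'a) \<Rightarrow> ('w \<Rightarrow> 'v) \<Rightarrow> ('a \<Rightarrow> 'e) \<Rightarrow> ('v \<Rightarrow> 'w) \<Rightarrow> bool" where
  "is_section A E pA pV sA sV \<longleftrightarrow>
     Vector_Spaces.linear (scaleA A) (scaleA E) sA \<and>
     Vector_Spaces.linear (scaleV A) (scaleV E) sV \<and>
     pA \<circ> sA = id \<and> pV \<circ> sV = id"

record ('a, 'v, 'b, 'm) sextuple =
  omega :: "'a \<Rightarrow> 'a \<Rightarrow> 'b"
  varpi :: "'a \<Rightarrow> 'v \<Rightarrow> 'm"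
  chi :: "'v \<Rightarrow> 'b"
  mu :: "'v \<Rightarrow> 'b \<Rightarrow> 'm"
  rhoB :: "'a \<Rightarrow> 'b \<Rightarrow> 'b"
  rhoM :: "'a \<Rightarrow> 'm \<Rightarrow> 'm"

text \<open>The defining expressions lie in \<open>range iB\<close> or \<open>range iM\<close> (lemma \<open>embed_induced_cocycle\<close> below),
  so \<open>inv iB\<close> and \<open>inv iM\<close> read them off as elements of \<open>B\<close> and \<open>M\<close>.\<close>

definition induced_cocycle ::
  "('k::field, 'a::ab_group_add, 'v::ab_group_add) rel_rb \<Rightarrow>
   ('k, 'e::ab_group_add, 'w::ab_group_add) rel_rb \<Rightarrow>
   ('b::ab_group_add \<Rightarrow> 'e) \<Rightarrow> ('m::ab_group_add \<Rightarrow> 'w) \<Rightarrow>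
   ('a \<Rightarrow> 'e) \<Rightarrow> ('v \<Rightarrow> 'w) \<Rightarrow> ('a, 'v, 'b, 'm) sextuple" where
  "induced_cocycle A E iB iM sA sV = \<lparr>
     omega = (\<lambda>x y. inv iB (brk E (sA x) (sA y) - sA (brk A x y))),
     varpi = (\<lambda>x v. inv iM (act E (sA x) (sV v) - sV (act A x v))),
     chi = (\<lambda>v. inv iB (rb_op E (sV v) - sA (rb_op A v))),
     mu = (\<lambda>v a. inv iM (- act E (iB a) (sV v))),
     rhoB = (\<lambda>x a. inv iB (brk E (sA x) (iB a))),
     rhoM = (\<lambda>x m. inv iM (act E (sA x) (iM m)))\<rparr>"

definition twist ::
  "('a \<Rightarrow> 'a) \<times> ('v \<Rightarrow> 'v) \<Rightarrow> ('b \<Rightarrow> 'b) \<times> ('m \<Rightarrow> 'm) \<Rightarrow>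
   ('a, 'v, 'b, 'm) sextuple \<Rightarrow> ('a, 'v, 'b, 'm) sextuple" where
  "twist = (\<lambda>(\<alpha>1, \<alpha>2) (\<beta>1, \<beta>2) c. \<lparr>
     omega = (\<lambda>x y. \<beta>1 (omega c (inv \<alpha>1 x) (inv \<alpha>1 y))),
     varpi = (\<lambda>x v. \<beta>2 (varpi c (inv \<alpha>1 x) (inv \<alpha>2 v))),
     chi = (\<lambda>v. \<beta>1 (chi c (inv \<alpha>2 v))),
     mu = (\<lambda>v a. \<beta>2 (mu c (inv \<alpha>2 v) (inv \<beta>1 a))),
     rhoB = (\<lambda>x a. \<beta>1 (rhoB c (inv \<alpha>1 x) (inv \<beta>1 a))),
     rhoM = (\<lambda>x m. \<beta>2 (rhoM c (inv \<alpha>1 x) (inv \<beta>2 m)))\<rparr>)"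

definition equivalent_cocycles ::
  "('k::field, 'a::ab_group_add, 'v::ab_group_add) rel_rb \<Rightarrow>
   ('k, 'b::ab_group_add, 'm::ab_group_add) rel_rb \<Rightarrow>
   ('a, 'v, 'b, 'm) sextuple \<Rightarrow> ('a, 'v, 'b, 'm) sextuple \<Rightarrow> bool" where
  "equivalent_cocycles A B c c' \<longleftrightarrow> (\<exists>\<zeta> \<eta>.
     Vector_Spaces.linear (scaleA A) (scaleA B) \<zeta> \<and>
     Vector_Spaces.linear (scaleV A) (scaleV B) \<eta> \<and>
     (\<forall>x y. omega c x y - omega c' x y
        = rhoB c' x (\<zeta> y) - rhoB c' y (\<zeta> x) - \<zeta> (brk A x y) + brk B (\<zeta> x) (\<zeta> y)) \<and>
     (\<forall>x a. rhoB c x a - rhoB c' x a = brk B (\<zeta> x) a) \<and>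
     (\<forall>x m. rhoM c x m - rhoM c' x m = act B (\<zeta> x) m) \<and>
     (\<forall>v a. mu c v a - mu c' v a = - act B a (\<eta> v)) \<and>
     (\<forall>v. chi c v - chi c' v = rb_op B (\<eta> v) - \<zeta> (rb_op A v)) \<and>
     (\<forall>x v. varpi c x v - varpi c' x v
        = rhoM c' x (\<eta> v) + act B (\<zeta> x) (\<eta> v) - mu c' v (\<zeta> x) - \<eta> (act A x v)))"

definition inducible ::
  "('k::field, 'e::ab_group_add, 'w::ab_group_add) rel_rb \<Rightarrow>
   ('b \<Rightarrow> 'e) \<Rightarrow> ('m \<Rightarrow> 'w) \<Rightarrow> ('e \<Rightarrow> 'a) \<Rightarrow> ('w \<Rightarrow> 'v) \<Rightarrow> ('a \<Rightarrow> 'e) \<Rightarrow> ('v \<Rightarrow> 'w) \<Rightarrow>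
   ('a \<Rightarrow> 'a) \<times> ('v \<Rightarrow> 'v) \<Rightarrow> ('b \<Rightarrow> 'b) \<times> ('m \<Rightarrow> 'm) \<Rightarrow> bool" where
  "inducible E iB iM pA pV sA sV \<alpha> \<beta> \<longleftrightarrow> (\<exists>\<gamma>1 \<gamma>2.
     (\<gamma>1, \<gamma>2) \<in> rel_rb_Aut E \<and>
     \<gamma>1 ` range iB \<subseteq> range iB \<and> \<gamma>2 ` range iM \<subseteq> range iM \<and>
     (pA \<circ> \<gamma>1 \<circ> sA, pV \<circ> \<gamma>2 \<circ> sV) = \<alpha> \<and>
     \<gamma>1 \<circ> iB = iB \<circ> fst \<beta> \<and> \<gamma>2 \<circ> iM = iM \<circ> snd \<beta>)"

lemma (in non_abelian_extension) embed_induced_cocycle: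
  assumes "is_section A E pA pV sA sV"
  defines "c \<equiv> induced_cocycle A E iB iM sA sV"
  shows "iB (omega c x y) = brk E (sA x) (sA y) - sA (brk A x y)"
    and "iM (varpi c x v) = act E (sA x) (sV v) - sV (act A x v)"
    and "iB (chi c v) = rb_op E (sV v) - sA (rb_op A v)"
    and "iM (mu c v b) = - act E (iB b) (sV v)"
    and "iB (rhoB c x b) = brk E (sA x) (iB b)"
    and "iM (rhoM c x m) = act E (sA x) (iM m)"
proof -
  have p: "Vector_Spaces.linear (scaleA E) (scaleA A) pA" "Vector_Spaces.linear (scaleV E) (scaleV A) pV"
    "\<And>x y. pA (brk E x y) = brk A (pA x) (pA y)" "\<And>v. pA (rb_op E v) = rb_op A (pV v)"
    "\<And>x v. pV (act E x v) = act A (pA x) (pV v)"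
    using p_hom by (auto simp: rel_rb_hom_def)
  have s: "pA (sA x) = x" "pV (sV v) = v" for x v
    using assms(1) by (auto simp: is_section_def fun_eq_iff)
  interpret lA: Vector_Spaces.linear "scaleA E" "scaleA A" pA by (rule p)
  interpret lV: Vector_Spaces.linear "scaleV E" "scaleV A" pV by (rule p)
  interpret br: Vector_Spaces.linear "scaleA A" "scaleA A" "brk A x" for x
    by (rule A.L.bracket_linear_right)
  interpret ac: Vector_Spaces.linear "scaleV A" "scaleV A" "act A x" for x
    by (rule A.action_linear)
  interpret acl: Vector_Spaces.linear "scaleA A" "scaleV A" "\<lambda>x. act A x v" for v
    by (rule A.action_linear_left)
  have B: "pA z = 0 \<Longrightarrow> iB (inv iB z) = z" for z
    using exact_A by (metis (mono_tags) f_inv_into_f mem_Collect_eq)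
  have M: "pV z = 0 \<Longrightarrow> iM (inv iM z) = z" for z
    using exact_V by (metis (mono_tags) f_inv_into_f mem_Collect_eq)
  have i: "pA (iB b) = 0" "pV (iM m) = 0" for b m
    using exact_A exact_V by auto
  note simps = c_def induced_cocycle_def p s i lA.diff lV.diff lA.neg lV.neg
    br.zero ac.zero acl.zero
  show "iB (omega c x y) = brk E (sA x) (sA y) - sA (brk A x y)"
    "iM (varpi c x v) = act E (sA x) (sV v) - sV (act A x v)"
    "iB (chi c v) = rb_op E (sV v) - sA (rb_op A v)"
    "iM (mu c v b) = - act E (iB b) (sV v)"
    "iB (rhoB c x b) = brk E (sA x) (iB b)"
    "iM (rhoM c x m) = act E (sA x) (iM m)"
    by (simp_all add: simps B M)
qed

end

theory Submission
  imports Defs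
begin

text \<open>The sextuples equivalent to the cocycle of a section are exactly the cocycles of the other
  sections, the difference of the two sections being \<open>(\<zeta>, \<eta>)\<close>. An automorphism \<open>\<gamma>\<close> that induces
  \<open>(\<alpha>, \<beta>)\<close> carries \<open>s\<close> to the section \<open>\<gamma> s \<alpha>\<inverse>\<close>, whose cocycle is the twisted one. Conversely,
  if the twisted cocycle belongs to a section \<open>s'\<close>, then \<open>s x + a \<mapsto> s' (\<alpha> x) + \<beta> a\<close> is an
  automorphism, because a section and its cocycle determine all operations of the extension.\<close>

section \<open>Inverses of linear bijections and of automorphisms\<close>

lemma linear_inv_bij:
  assumes "Vector_Spaces.linear s1 s2 f" and "bij f"
  shows "Vector_Spaces.linear s2 s1 (inv f)"
proof -
  interpret Vector_Spaces.linear s1 s2 f by (rule assms)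
  have f: "f (inv f y) = y" for y
    using assms(2) by (simp add: bij_is_surj surj_f_inv_f)
  have g: "inv f y = x" if "f x = y" for x y
    using that assms(2) by (auto simp: bij_is_inj)
  show ?thesis
    by unfold_locales (auto intro!: g simp: add scale f)
qed

text \<open>Applied to \<alpha>: the section \<open>\<gamma> \<circ> s \<circ> inv \<alpha>\<close>
  has a computable cocycle because \<open>inv \<alpha>\<close> respects all operations as
  well.\<close>

lemma rel_rb_Aut_inv:
  assumes "(f, g) \<in> rel_rb_Aut R"
  shows "(inv f, inv g) \<in> rel_rb_Aut R"
proof -
  have *: "Vector_Spaces.linear (scaleA R) (scaleA R) f"
    "\<And>x y. f (brk R x y) = brk R (f x) (f y)"
    "Vector_Spaces.linear (scaleV R) (scaleV R) g"
    "\<And>v. rb_op R (g v) = f (rb_op R v)" "\<And>x v. g (act R x v) = act R (f x) (g v)"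
    and bij: "bij f" "bij g"
    using assms by (auto simp: rel_rb_Aut_def rel_rb_hom_def)
  have surj: "f (inv f x) = x" "g (inv g v) = v" for x v
    using bij by (simp_all add: bij_is_surj surj_f_inv_f)
  \<comment> \<open>An inverse is evaluated by naming a preimage, which reduces each identity below
    to the corresponding one for \<open>f\<close> and \<open>g\<close>.\<close>
  have inv: "f x = y \<Longrightarrow> inv f y = x" "g v = w \<Longrightarrow> inv g w = v" for x y v w
    using bij by (auto simp: bij_is_inj)
  have "inv f (brk R x y) = brk R (inv f x) (inv f y)" for x y
    by (rule inv) (simp add: * surj)
  moreover have "rb_op R (inv g v) = inv f (rb_op R v)" for v
    by (rule inv(1)[symmetric]) (simp flip: *(4) add: surj)
  moreover have "inv g (act R x v) = act R (inv f x) (inv g v)" for x v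
    by (rule inv) (simp add: * surj)
  ultimately show ?thesis
    using linear_inv_bij[OF *(1) bij(1)] linear_inv_bij[OF *(3) bij(2)] bij
    by (simp add: rel_rb_Aut_def rel_rb_hom_def bij_imp_bij_inv)
qed

section \<open>Splittings of short exact sequences of vector spaces\<close>

text \<open>Applying \<open>p\<close> to a sum recovers \<open>x\<close>, and then injectivity of
  \<open>i\<close> recovers \<open>a\<close>. Every \<open>e\<close> is reached because
  \<open>e - s (p e)\<close> lies in the kernel of \<open>p\<close>.\<close>

lemma bij_section_plus_kernel:
  assumes "Vector_Spaces.linear sE sA p" and "inj i" and "range i = {x. p x = 0}"
    and "p \<circ> s = id"
  shows "bij (\<lambda>(x, a). s x + i a)"
proof -
  interpret p: Vector_Spaces.linear sE sA p by (rule assms)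
  have ps: "p (s x) = x" for x
    using assms(4) by (simp add: fun_eq_iff)
  have pi: "p (i a) = 0" for a
    using assms(3) by auto
  have "x = y \<and> a = b" if "s x + i a = s y + i b" for x y a b
  proof -
    have "p (s x + i a) = p (s y + i b)" using that by simp
    then have "x = y" by (simp add: p.add ps pi)
    with that show ?thesis using assms(2) by (simp add: inj_eq)
  qed
  moreover have "\<exists>x a. e = s x + i a" for e
  proof -
    have "p (e - s (p e)) = 0" by (simp add: p.diff ps)
    then obtain a where "e - s (p e) = i a" using assms(3) by blast
    then have "e = s (p e) + i a" by (simp add: algebra_simps)
    then show ?thesis by blast
  qed
  ultimately show ?thesis
    by (auto simp: bij_def inj_on_def image_def)
qed

text \<open>A splitting identifies the total space with the product of quotient and kernel. Read in
  the coordinates of \<open>s\<close> on the source and of \<open>s'\<close> on the target,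
  \<open>h\<close> is \<open>map_prod f g\<close>. This is how a pair (\<alpha>, \<beta>) gets
  lifted to the extension.\<close>

lemma bij_linear_between_splittings:
  assumes i: "Vector_Spaces.linear sB sE i" "inj i" "range i = {x. p x = 0}"
    and p: "Vector_Spaces.linear sE sA p"
    and s: "Vector_Spaces.linear sA sE s" "p \<circ> s = id"
    and s': "Vector_Spaces.linear sA sE s'" "p \<circ> s' = id"
    and f: "Vector_Spaces.linear sA sA f" "bij f"
    and g: "Vector_Spaces.linear sB sB g" "bij g"
  obtains h where "Vector_Spaces.linear sE sE h" "bij h"
    "\<And>x a. h (s x + i a) = s' (f x) + i (g a)"
proof -
  define \<Phi> where "\<Phi> = (\<lambda>(x, a). s x + i a)"
  define \<Phi>' where "\<Phi>' = (\<lambda>(x, a). s' x + i a)"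
  define h where "h = \<Phi>' \<circ> map_prod f g \<circ> inv \<Phi>"
  have \<Phi>: "bij \<Phi>" "bij \<Phi>'"
    unfolding \<Phi>_def \<Phi>'_def using bij_section_plus_kernel[OF p i(2,3)] s s' by blast+
  have fg: "bij (map_prod f g)"
    using f(2) g(2) by (simp add: bij_def prod.inj_map map_prod_surj)
  have h: "h (s x + i a) = s' (f x) + i (g a)" for x a
  proof -
    have "s x + i a = \<Phi> (x, a)" by (simp add: \<Phi>_def)
    then show ?thesis using \<Phi>(1) by (simp add: h_def bij_is_inj) (simp add: \<Phi>'_def)
  qed
  have split: "\<exists>x a. e = s x + i a" for e
    using \<Phi>(1) unfolding \<Phi>_def bij_def by (metis (mono_tags, lifting) case_prod_beta surjD)
  interpret i: Vector_Spaces.linear sB sE i by (rule i)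
  interpret s: Vector_Spaces.linear sA sE s by (rule s)
  interpret s': Vector_Spaces.linear sA sE s' by (rule s')
  interpret f: Vector_Spaces.linear sA sA f by (rule f)
  interpret g: Vector_Spaces.linear sB sB g by (rule g)
  \<comment> \<open>Every vector has the form \<open>s x + i a\<close>, on which \<open>h\<close> is
    explicit, so linearity of \<open>h\<close> is inherited from \<open>s\<close>,
    \<open>s'\<close>, \<open>i\<close>, \<open>f\<close> and \<open>g\<close>.\<close>
  have add: "h (d + e) = h d + h e" for d e
  proof -
    obtain x a y b where de: "d = s x + i a" "e = s y + i b" using split by metis
    then have "d + e = s (x + y) + i (a + b)" by (simp add: s.add i.add)
    then have "h (d + e) = s' (f (x + y)) + i (g (a + b))" by (simp only: h)
    then show ?thesis
      unfolding de h by (simp add: s'.add i.add f.add g.add)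
  qed
  have scale: "h (sE r e) = sE r (h e)" for r e
  proof -
    obtain x a where e: "e = s x + i a" using split by blast
    then have "sE r e = s (sA r x) + i (sB r a)"
      by (simp add: s.scale i.scale i.vs2.scale_right_distrib)
    then have "h (sE r e) = s' (f (sA r x)) + i (g (sB r a))" by (simp only: h)
    then show ?thesis
      unfolding e h by (simp add: s'.scale i.scale f.scale g.scale i.vs2.scale_right_distrib)
  qed
  have "Vector_Spaces.linear sE sE h"
    by unfold_locales (simp_all add: add scale)
  moreover have "bij h"
    unfolding h_def using \<Phi> fg by (intro bij_comp bij_imp_bij_inv)
  ultimately show thesis using h that by blast
qed

section \<open>Biadditivity and antisymmetry of the operations\<close>

context lie_representation
begin

lemma bracket_add: "bracket (x + y) z = bracket x z + bracket y z"
    "bracket x (y + z) = bracket x y + bracket x z"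
  using L.bracket_linear_left[of z] L.bracket_linear_right[of x]
  by (auto simp: Vector_Spaces.linear_iff)

text \<open>Polarisation of the alternating law at \<open>x + y\<close>, valid in every
  characteristic.\<close>

lemma bracket_antisym: "bracket x y = - bracket y x"
proof -
  have "bracket (x + y) (x + y) = 0" by (rule L.bracket_alternating)
  then have "bracket x y + bracket y x = 0"
    unfolding bracket_add by (simp add: L.bracket_alternating add.commute)
  then show ?thesis by (simp add: eq_neg_iff_add_eq_0)
qed

lemma action_add: "action (x + y) v = action x v + action y v"
    "action x (v + w) = action x v + action x w"
  using action_linear[of x] action_linear_left[of v]
  by (auto simp: Vector_Spaces.linear_iff)

end

section \<open>The extension in the coordinates given by a section\<close>

context non_abelian_extension
begin

abbreviation splitting :: "('a \<Rightarrow> 'e) \<Rightarrow> ('v \<Rightarrow> 'w) \<Rightarrow> bool" where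
  "splitting \<equiv> is_section A E pA pV"

abbreviation cocycle :: "('a \<Rightarrow> 'e) \<Rightarrow> ('v \<Rightarrow> 'w) \<Rightarrow> ('a, 'v, 'b, 'm) sextuple" where
  "cocycle \<equiv> induced_cocycle A E iB iM"

lemma i_props:
  "Vector_Spaces.linear (scaleA B) (scaleA E) iB" "Vector_Spaces.linear (scaleV B) (scaleV E) iM"
  "iB (brk B a b) = brk E (iB a) (iB b)" "iM (act B a m) = act E (iB a) (iM m)"
  "iB (rb_op B m) = rb_op E (iM m)"
  using i_hom by (auto simp: rel_rb_hom_def)

sublocale iB: Vector_Spaces.linear "scaleA B" "scaleA E" iB
  by (rule i_props)

sublocale iM: Vector_Spaces.linear "scaleV B" "scaleV E" iM
  by (rule i_props)

lemma p_linear: "Vector_Spaces.linear (scaleA E) (scaleA A) pA"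
    "Vector_Spaces.linear (scaleV E) (scaleV A) pV"
  using p_hom by (auto simp: rel_rb_hom_def)

sublocale pA: Vector_Spaces.linear "scaleA E" "scaleA A" pA
  by (rule p_linear)

sublocale pV: Vector_Spaces.linear "scaleV E" "scaleV A" pV
  by (rule p_linear)

sublocale T: Vector_Spaces.linear "scaleV E" "scaleA E" "rb_op E"
  by (rule E.rb_op_linear)

lemma p_i: "pA (iB a) = 0" "pV (iM m) = 0"
  using exact_A exact_V by auto

lemma embed_inv: "pA e = 0 \<Longrightarrow> iB (inv iB e) = e" "pV w = 0 \<Longrightarrow> iM (inv iM w) = w"
  using exact_A exact_V by (auto intro!: f_inv_into_f)

text \<open>Biadditive expansion: terms in the section alone give the operation of \<open>A\<close>
  plus \<open>omega\<close>, \<open>varpi\<close> or \<open>chi\<close>, mixed terms give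
  \<open>rhoB\<close>, \<open>rhoM\<close> or \<open>mu\<close>, and terms in the kernel alone give
  the operation of \<open>B\<close>. The minus before \<open>mu\<close> undoes the sign in its
  definition.\<close>

lemma operations_via_cocycle:
  assumes "splitting s t"
  defines "c \<equiv> cocycle s t"
  shows "brk E (s x + iB a) (s y + iB b)
      = s (brk A x y) + iB (omega c x y + rhoB c x b - rhoB c y a + brk B a b)"
    and "act E (s x + iB a) (t v + iM m)
      = t (act A x v) + iM (varpi c x v + rhoM c x m - mu c v a + act B a m)"
    and "rb_op E (t v + iM m) = s (rb_op A v) + iB (chi c v + rb_op B m)"
  \<comment> \<open>\<open>rhoB\<close> covers only brackets with the section on the left, so the
    other cross term is turned around.\<close>
  using E.bracket_antisym[of "iB a" "s y"]
  by (simp_all add: c_def embed_induced_cocycle[OF assms(1)] i_props iB.add iB.diff iM.add iM.diff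
      T.add E.bracket_add E.action_add)

text \<open>Since \<open>iB\<close> and \<open>iM\<close> are injective, a sextuple is determined by
  its embedded values, and these are expressions in \<open>E\<close> free of
  \<open>inv\<close>.\<close>

lemma cocycle_eqI:
  assumes "splitting s t"
    and "\<And>x y. iB (omega c x y) = brk E (s x) (s y) - s (brk A x y)"
    and "\<And>x v. iM (varpi c x v) = act E (s x) (t v) - t (act A x v)"
    and "\<And>v. iB (chi c v) = rb_op E (t v) - s (rb_op A v)"
    and "\<And>v a. iM (mu c v a) = - act E (iB a) (t v)"
    and "\<And>x a. iB (rhoB c x a) = brk E (s x) (iB a)"
    and "\<And>x m. iM (rhoM c x m) = act E (s x) (iM m)"
  shows "c = cocycle s t"
  by (rule sextuple.equality)
    (auto simp: fun_eq_iff assms embed_induced_cocycle[OF assms(1)]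
      intro!: injD[OF inj_iB] injD[OF inj_iM])

section \<open>Change of section and equivalence of cocycles\<close>

text \<open>The projections kill the difference of two sections, so by exactness it comes from
  \<open>B\<close> and \<open>M\<close>. Linearity is checked after embedding, by
  injectivity.\<close>

lemma splitting_diff_linear:
  assumes "splitting s t" and "splitting s' t'"
  obtains \<zeta> \<eta> where "Vector_Spaces.linear (scaleA A) (scaleA B) \<zeta>"
    "Vector_Spaces.linear (scaleV A) (scaleV B) \<eta>"
    "\<And>x. s x = s' x + iB (\<zeta> x)" "\<And>v. t v = t' v + iM (\<eta> v)"
proof -
  have st: "Vector_Spaces.linear (scaleA A) (scaleA E) s" "Vector_Spaces.linear (scaleV A) (scaleV E) t"
    "Vector_Spaces.linear (scaleA A) (scaleA E) s'" "Vector_Spaces.linear (scaleV A) (scaleV E) t'"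
    and p: "pA (s x) = x" "pV (t v) = v" "pA (s' x) = x" "pV (t' v) = v" for x v
    using assms by (auto simp: is_section_def fun_eq_iff)
  define \<zeta> where "\<zeta> x = inv iB (s x - s' x)" for x
  define \<eta> where "\<eta> v = inv iM (t v - t' v)" for v
  have d: "iB (\<zeta> x) = s x - s' x" "iM (\<eta> v) = t v - t' v" for x v
    by (simp_all add: \<zeta>_def \<eta>_def embed_inv pA.diff pV.diff p)
  have "Vector_Spaces.linear (scaleA A) (scaleA B) \<zeta>"
    unfolding Vector_Spaces.linear_iff
    using A.L.vector_space_axioms B.L.vector_space_axioms st
    by (auto intro!: injD[OF inj_iB] simp: d iB.add iB.scale Vector_Spaces.linear_iff
      E.L.scale_right_diff_distrib)
  moreover have "Vector_Spaces.linear (scaleV A) (scaleV B) \<eta>"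
    unfolding Vector_Spaces.linear_iff
    using A.V.vector_space_axioms B.V.vector_space_axioms st
    by (auto intro!: injD[OF inj_iM] simp: d iM.add iM.scale Vector_Spaces.linear_iff
      E.V.scale_right_diff_distrib)
  ultimately show thesis
    by (rule that) (simp_all add: d)
qed

text \<open>Converse of \<open>splitting_diff_linear\<close>: the sections form an affine space over
  the pairs (\<zeta>, \<eta>).\<close>

lemma splitting_shift:
  assumes "splitting s t"
    and "Vector_Spaces.linear (scaleA A) (scaleA B) \<zeta>" "Vector_Spaces.linear (scaleV A) (scaleV B) \<eta>"
  shows "splitting (\<lambda>x. s x - iB (\<zeta> x)) (\<lambda>v. t v - iM (\<eta> v))"
  using assms
  by (auto simp: is_section_def fun_eq_iff Vector_Spaces.linear_iff pA.diff pV.diff p_i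
      iB.add iB.scale iM.add iM.scale E.L.scale_right_diff_distrib E.V.scale_right_diff_distrib)

text \<open>Substituting \<open>s = s' + iB \<zeta>\<close> and \<open>t = t' + iM \<eta>\<close>
  into the cocycle of (s, t) and expanding turns the six equations of equivalence into the six
  defining formulas for the cocycle of (s', t').\<close>

lemma equivalent_cocycles_iff_splitting:
  assumes "splitting s t"
  shows "equivalent_cocycles A B (cocycle s t) c' \<longleftrightarrow>
    (\<exists>s' t'. splitting s' t' \<and> c' = cocycle s' t')"
proof
  note c = embed_induced_cocycle[OF assms]
  note lin = iB.add iB.diff iB.neg iM.add iM.diff iM.neg T.add
  {
    assume "equivalent_cocycles A B (cocycle s t) c'"
    then obtain \<zeta> \<eta> where
      \<zeta>: "Vector_Spaces.linear (scaleA A) (scaleA B) \<zeta>" and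
      \<eta>: "Vector_Spaces.linear (scaleV A) (scaleV B) \<eta>" and
      omega: "\<And>x y. omega (cocycle s t) x y - omega c' x y
        = rhoB c' x (\<zeta> y) - rhoB c' y (\<zeta> x) - \<zeta> (brk A x y) + brk B (\<zeta> x) (\<zeta> y)" and
      rhoB: "\<And>x a. rhoB (cocycle s t) x a - rhoB c' x a = brk B (\<zeta> x) a" and
      rhoM: "\<And>x m. rhoM (cocycle s t) x m - rhoM c' x m = act B (\<zeta> x) m" and
      mu: "\<And>v a. mu (cocycle s t) v a - mu c' v a = - act B a (\<eta> v)" and
      chi: "\<And>v. chi (cocycle s t) v - chi c' v = rb_op B (\<eta> v) - \<zeta> (rb_op A v)" and
      varpi: "\<And>x v. varpi (cocycle s t) x v - varpi c' x v
        = rhoM c' x (\<eta> v) + act B (\<zeta> x) (\<eta> v) - mu c' v (\<zeta> x) - \<eta> (act A x v)"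
      unfolding equivalent_cocycles_def by blast
    \<comment> \<open>Subtracting \<zeta> and \<eta> matches the convention that they measure the
      first sextuple minus the second.\<close>
    define s' where "s' x = s x - iB (\<zeta> x)" for x
    define t' where "t' v = t v - iM (\<eta> v)" for v
    have s: "s x = s' x + iB (\<zeta> x)" and t: "t v = t' v + iM (\<eta> v)" for x v
      by (simp_all add: s'_def t'_def)
    have split': "splitting s' t'"
      using splitting_shift[OF assms \<zeta> \<eta>] by (simp add: s'_def[abs_def] t'_def[abs_def])
    note simps = c lin i_props s t E.bracket_add E.action_add
    \<comment> \<open>Each equation is embedded into \<open>E\<close> and solved for the component
      of \<open>c'\<close>. \<open>B\<close>, \<open>M\<close> and \<open>U\<close> come first
      because the equations for \<open>omega\<close> and \<open>varpi\<close> contain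
      \<open>rhoB c'\<close>, \<open>rhoM c'\<close> and \<open>mu c'\<close>.\<close>
    have B: "iB (rhoB c' x a) = brk E (s' x) (iB a)" for x a
      using arg_cong[OF rhoB, of iB x a] by (simp add: simps)
    have M: "iM (rhoM c' x m) = act E (s' x) (iM m)" for x m
      using arg_cong[OF rhoM, of iM x m] by (simp add: simps)
    have U: "iM (mu c' v a) = - act E (iB a) (t' v)" for v a
      using arg_cong[OF mu, of iM v a] by (simp add: simps)
    have C: "iB (chi c' v) = rb_op E (t' v) - s' (rb_op A v)" for v
      using arg_cong[OF chi, of iB v] by (simp add: simps algebra_simps)
    have O: "iB (omega c' x y) = brk E (s' x) (s' y) - s' (brk A x y)" for x y
      \<comment> \<open>Expanding the bracket of \<open>s x\<close> and \<open>s y\<close> gives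
        this cross term with \<zeta> on the left, while \<open>rhoB c' y (\<zeta> x)\<close> has it
        on the right.\<close>
      using arg_cong[OF omega, of iB x y] E.bracket_antisym[of "s' y" "iB (\<zeta> x)"]
      by (simp add: simps B algebra_simps)
    have P: "iM (varpi c' x v) = act E (s' x) (t' v) - t' (act A x v)" for x v
      using arg_cong[OF varpi, of iM x v] by (simp add: simps M U algebra_simps)
    show "\<exists>s' t'. splitting s' t' \<and> c' = cocycle s' t'"
      using split' cocycle_eqI[OF split' O P C U B M] by blast
  next
    assume "\<exists>s' t'. splitting s' t' \<and> c' = cocycle s' t'"
    then obtain s' t' where split': "splitting s' t'" and c': "c' = cocycle s' t'"
      by blast
    obtain \<zeta> \<eta> where \<zeta>\<eta>: "Vector_Spaces.linear (scaleA A) (scaleA B) \<zeta>"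
      "Vector_Spaces.linear (scaleV A) (scaleV B) \<eta>"
      and st: "\<And>x. s x = s' x + iB (\<zeta> x)" "\<And>v. t v = t' v + iM (\<eta> v)"
      using splitting_diff_linear[OF assms split'] by blast
    note simps = c embed_induced_cocycle[OF split'] lin i_props st E.bracket_add E.action_add
    \<comment> \<open>The \<open>omega\<close> equation again contains this cross term in both
      orders. All six equations are then compared after embedding.\<close>
    have "brk E (s' y) (iB (\<zeta> x)) = - brk E (iB (\<zeta> x)) (s' y)" for x y
      by (rule E.bracket_antisym)
    with \<zeta>\<eta> show "equivalent_cocycles A B (cocycle s t) c'"
      unfolding equivalent_cocycles_def c'
      by (intro exI[of _ \<zeta>] exI[of _ \<eta>] conjI allI injD[OF inj_iB] injD[OF inj_iM])
        (simp_all add: simps algebra_simps)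
  }
qed

section \<open>Inducible pairs and sections\<close>

text \<open>The right-hand side is that of \<open>equivalent_cocycles_iff_splitting\<close> for the
  twisted cocycle, so inducibility and equivalence meet in it.\<close>

lemma inducible_iff_splitting:
  assumes split: "splitting s t"
    and \<alpha>: "(\<alpha>1, \<alpha>2) \<in> rel_rb_Aut A" and \<beta>: "(\<beta>1, \<beta>2) \<in> rel_rb_Aut B"
  shows "inducible E iB iM pA pV s t (\<alpha>1, \<alpha>2) (\<beta>1, \<beta>2) \<longleftrightarrow>
    (\<exists>s' t'. splitting s' t' \<and> twist (\<alpha>1, \<alpha>2) (\<beta>1, \<beta>2) (cocycle s t) = cocycle s' t')"
proof
  note \<alpha>' = rel_rb_Aut_inv[OF \<alpha>]
  have bij: "bij \<alpha>1" "bij \<alpha>2" "bij \<beta>1" "bij \<beta>2"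
    using \<alpha> \<beta> by (auto simp: rel_rb_Aut_def)
  have inv: "\<alpha>1 (inv \<alpha>1 x) = x" "\<alpha>2 (inv \<alpha>2 v) = v" "\<beta>1 (inv \<beta>1 a) = a" "\<beta>2 (inv \<beta>2 m) = m"
    "inv \<alpha>1 (\<alpha>1 x) = x" "inv \<alpha>2 (\<alpha>2 v) = v" "inv \<beta>1 (\<beta>1 a) = a" "inv \<beta>2 (\<beta>2 m) = m" for x v a m
    using bij by (simp_all add: bij_is_surj bij_is_inj surj_f_inv_f)
  have st: "Vector_Spaces.linear (scaleA A) (scaleA E) s" "Vector_Spaces.linear (scaleV A) (scaleV E) t"
    using split by (auto simp: is_section_def)
  {
    assume "inducible E iB iM pA pV s t (\<alpha>1, \<alpha>2) (\<beta>1, \<beta>2)"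
    then obtain \<gamma>1 \<gamma>2 where \<gamma>: "(\<gamma>1, \<gamma>2) \<in> rel_rb_Aut E"
      and p\<gamma>s: "pA \<circ> \<gamma>1 \<circ> s = \<alpha>1" "pV \<circ> \<gamma>2 \<circ> t = \<alpha>2"
      and "\<gamma>1 \<circ> iB = iB \<circ> \<beta>1" "\<gamma>2 \<circ> iM = iM \<circ> \<beta>2"
      unfolding inducible_def by auto
    \<comment> \<open>Oriented to replace \<beta> by \<gamma>: an embedded component of the twist
      becomes \<gamma> applied to an embedded component of the original cocycle.\<close>
    then have \<gamma>i: "iB (\<beta>1 a) = \<gamma>1 (iB a)" "iM (\<beta>2 m) = \<gamma>2 (iM m)" for a m
      by (simp_all add: fun_eq_iff)
    \<comment> \<open>These absorb the \<open>inv \<beta>1\<close> and \<open>inv \<beta>2\<close>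
      inside the twisted \<open>mu\<close>, \<open>rhoB\<close> and \<open>rhoM\<close>.\<close>
    then have \<gamma>i_inv: "\<gamma>1 (iB (inv \<beta>1 a)) = iB a" "\<gamma>2 (iM (inv \<beta>2 m)) = iM m" for a m
      by (metis inv(3), metis inv(4))
    have \<gamma>_hom: "Vector_Spaces.linear (scaleA E) (scaleA E) \<gamma>1"
      "Vector_Spaces.linear (scaleV E) (scaleV E) \<gamma>2"
      "\<gamma>1 (brk E e e') = brk E (\<gamma>1 e) (\<gamma>1 e')" "\<gamma>2 (act E e w) = act E (\<gamma>1 e) (\<gamma>2 w)"
      "\<gamma>1 (rb_op E w) = rb_op E (\<gamma>2 w)" for e e' w
      using \<gamma> by (auto simp: rel_rb_Aut_def rel_rb_hom_def)
    have \<alpha>_inv: "Vector_Spaces.linear (scaleA A) (scaleA A) (inv \<alpha>1)"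
      "Vector_Spaces.linear (scaleV A) (scaleV A) (inv \<alpha>2)"
      "inv \<alpha>1 (brk A x y) = brk A (inv \<alpha>1 x) (inv \<alpha>1 y)"
      "inv \<alpha>2 (act A x v) = act A (inv \<alpha>1 x) (inv \<alpha>2 v)"
      "inv \<alpha>1 (rb_op A v) = rb_op A (inv \<alpha>2 v)" for x y v
      using \<alpha>' by (auto simp: rel_rb_Aut_def rel_rb_hom_def)
    interpret \<gamma>1: Vector_Spaces.linear "scaleA E" "scaleA E" \<gamma>1 by (rule \<gamma>_hom)
    interpret \<gamma>2: Vector_Spaces.linear "scaleV E" "scaleV E" \<gamma>2 by (rule \<gamma>_hom)
    \<comment> \<open>As \<gamma> induces \<alpha> through the section, precomposing with the
      inverse of \<alpha> restores the section property.\<close>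
    define s' where "s' = \<gamma>1 \<circ> s \<circ> inv \<alpha>1"
    define t' where "t' = \<gamma>2 \<circ> t \<circ> inv \<alpha>2"
    have split': "splitting s' t'"
      using p\<gamma>s inv \<alpha>_inv(1,2) st \<gamma>_hom(1,2)
      by (simp add: is_section_def s'_def t'_def fun_eq_iff Vector_Spaces.linear_iff)
    have "twist (\<alpha>1, \<alpha>2) (\<beta>1, \<beta>2) (cocycle s t) = cocycle s' t'"
      by (rule cocycle_eqI[OF split'])
        (simp_all add: twist_def \<gamma>i embed_induced_cocycle[OF split] \<gamma>1.diff \<gamma>2.diff \<gamma>2.neg
          \<gamma>_hom(3-) \<alpha>_inv(3-) s'_def t'_def \<gamma>i_inv)
    with split' show "\<exists>s' t'. splitting s' t' \<and>
        twist (\<alpha>1, \<alpha>2) (\<beta>1, \<beta>2) (cocycle s t) = cocycle s' t'"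
      by blast
  next
    assume "\<exists>s' t'. splitting s' t' \<and>
      twist (\<alpha>1, \<alpha>2) (\<beta>1, \<beta>2) (cocycle s t) = cocycle s' t'"
    then obtain s' t' where split': "splitting s' t'"
      and tw: "cocycle s' t' = twist (\<alpha>1, \<alpha>2) (\<beta>1, \<beta>2) (cocycle s t)"
      by metis
    have st': "Vector_Spaces.linear (scaleA A) (scaleA E) s'" "Vector_Spaces.linear (scaleV A) (scaleV E) t'"
      and ps: "pA \<circ> s = id" "pV \<circ> t = id" "pA \<circ> s' = id" "pV \<circ> t' = id"
      using split split' by (auto simp: is_section_def)
    have \<alpha>_hom: "Vector_Spaces.linear (scaleA A) (scaleA A) \<alpha>1"
      "Vector_Spaces.linear (scaleV A) (scaleV A) \<alpha>2"
      "\<alpha>1 (brk A x y) = brk A (\<alpha>1 x) (\<alpha>1 y)"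
      "\<alpha>2 (act A x v) = act A (\<alpha>1 x) (\<alpha>2 v)"
      "\<alpha>1 (rb_op A v) = rb_op A (\<alpha>2 v)" for x y v
      using \<alpha> by (auto simp: rel_rb_Aut_def rel_rb_hom_def)
    have \<beta>_hom: "Vector_Spaces.linear (scaleA B) (scaleA B) \<beta>1"
      "Vector_Spaces.linear (scaleV B) (scaleV B) \<beta>2"
      "\<beta>1 (brk B a b) = brk B (\<beta>1 a) (\<beta>1 b)"
      "\<beta>2 (act B a m) = act B (\<beta>1 a) (\<beta>2 m)"
      "\<beta>1 (rb_op B m) = rb_op B (\<beta>2 m)" for a b m
      using \<beta> by (auto simp: rel_rb_Aut_def rel_rb_hom_def)
    interpret \<beta>1: Vector_Spaces.linear "scaleA B" "scaleA B" \<beta>1 by (rule \<beta>_hom)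
    interpret \<beta>2: Vector_Spaces.linear "scaleV B" "scaleV B" \<beta>2 by (rule \<beta>_hom)
    interpret s: Vector_Spaces.linear "scaleA A" "scaleA E" s by (rule st)
    interpret t: Vector_Spaces.linear "scaleV A" "scaleV E" t by (rule st)
    interpret s': Vector_Spaces.linear "scaleA A" "scaleA E" s' by (rule st')
    interpret t': Vector_Spaces.linear "scaleV A" "scaleV E" t' by (rule st')
    interpret \<alpha>1: Vector_Spaces.linear "scaleA A" "scaleA A" \<alpha>1 by (rule \<alpha>_hom)
    interpret \<alpha>2: Vector_Spaces.linear "scaleV A" "scaleV A" \<alpha>2 by (rule \<alpha>_hom)
    \<comment> \<open>The lift acts as \<alpha> on section coordinates and as \<beta> on kernel
      coordinates while replacing (s, t) by (s', t'). Linearity and bijectivity come for free;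
      compatibility with the operations remains.\<close>
    obtain \<gamma>1 where \<gamma>1: "Vector_Spaces.linear (scaleA E) (scaleA E) \<gamma>1" "bij \<gamma>1"
      "\<And>x a. \<gamma>1 (s x + iB a) = s' (\<alpha>1 x) + iB (\<beta>1 a)"
      using bij_linear_between_splittings[OF i_props(1) inj_iB exact_A p_linear(1) st(1) ps(1)
          st'(1) ps(3) \<alpha>_hom(1) bij(1) \<beta>_hom(1) bij(3)] by blast
    obtain \<gamma>2 where \<gamma>2: "Vector_Spaces.linear (scaleV E) (scaleV E) \<gamma>2" "bij \<gamma>2"
      "\<And>v m. \<gamma>2 (t v + iM m) = t' (\<alpha>2 v) + iM (\<beta>2 m)"
      using bij_linear_between_splittings[OF i_props(2) inj_iM exact_V p_linear(2) st(2) ps(2)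
          st'(2) ps(4) \<alpha>_hom(2) bij(2) \<beta>_hom(2) bij(4)] by blast
    have splitA: "\<exists>x a. e = s x + iB a" for e
      using bij_section_plus_kernel[OF p_linear(1) inj_iB exact_A ps(1)]
      by (auto simp: bij_def surj_def)
    have splitV: "\<exists>v m. w = t v + iM m" for w
      using bij_section_plus_kernel[OF p_linear(2) inj_iM exact_V ps(2)]
      by (auto simp: bij_def surj_def)
    \<comment> \<open>Through \<open>tw\<close>, the operations in both splittings are expressed by
      the same cocycle. At arguments of the form \<open>\<alpha>1 x\<close>,
      \<open>\<alpha>2 v\<close>, \<open>\<beta>1 a\<close>, \<open>\<beta>2 m\<close> the inverses
      in the twist cancel, leaving \<beta> applied to the untwisted component.\<close>
    note op = operations_via_cocycle[OF split] operations_via_cocycle[OF split', unfolded tw]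
    note simps = op \<gamma>1(3) \<gamma>2(3) twist_def inv \<alpha>_hom(3-) \<beta>_hom(3-) \<beta>1.add \<beta>1.diff \<beta>2.add \<beta>2.diff
    have brk: "\<gamma>1 (brk E e e') = brk E (\<gamma>1 e) (\<gamma>1 e')" for e e'
    proof -
      obtain x a y b where "e = s x + iB a" "e' = s y + iB b" using splitA by metis
      then show ?thesis by (simp add: simps)
    qed
    have act: "\<gamma>2 (act E e w) = act E (\<gamma>1 e) (\<gamma>2 w)" for e w
    proof -
      obtain x a v m where "e = s x + iB a" "w = t v + iM m" using splitA splitV by metis
      then show ?thesis by (simp add: simps)
    qed
    have rb: "rb_op E (\<gamma>2 w) = \<gamma>1 (rb_op E w)" for w
    proof -
      obtain v m where "w = t v + iM m" using splitV by metis
      then show ?thesis by (simp add: simps)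
    qed
    \<comment> \<open>A zero kernel coordinate shows that \<gamma> induces \<alpha>; a zero section
      coordinate shows that it restricts to \<beta>.\<close>
    have \<gamma>_s: "\<gamma>1 (s x) = s' (\<alpha>1 x)" "\<gamma>2 (t v) = t' (\<alpha>2 v)" for x v
      using \<gamma>1(3)[of x 0] \<gamma>2(3)[of v 0]
      by (simp_all add: iB.zero iM.zero \<beta>1.zero \<beta>2.zero)
    have \<gamma>_i: "\<gamma>1 (iB a) = iB (\<beta>1 a)" "\<gamma>2 (iM m) = iM (\<beta>2 m)" for a m
      using \<gamma>1(3)[of 0 a] \<gamma>2(3)[of 0 m]
      by (simp_all add: s.zero t.zero s'.zero t'.zero \<alpha>1.zero \<alpha>2.zero)
    show "inducible E iB iM pA pV s t (\<alpha>1, \<alpha>2) (\<beta>1, \<beta>2)"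
      unfolding inducible_def
    proof (intro exI conjI)
      show "(\<gamma>1, \<gamma>2) \<in> rel_rb_Aut E"
        using \<gamma>1 \<gamma>2 brk act rb by (simp add: rel_rb_Aut_def rel_rb_hom_def)
      show "\<gamma>1 ` range iB \<subseteq> range iB" "\<gamma>2 ` range iM \<subseteq> range iM"
        by (auto simp: \<gamma>_i)
      show "(pA \<circ> \<gamma>1 \<circ> s, pV \<circ> \<gamma>2 \<circ> t) = (\<alpha>1, \<alpha>2)"
        using ps by (simp add: fun_eq_iff \<gamma>_s)
      show "\<gamma>1 \<circ> iB = iB \<circ> fst (\<beta>1, \<beta>2)" "\<gamma>2 \<circ> iM = iM \<circ> snd (\<beta>1, \<beta>2)"
        by (simp_all add: fun_eq_iff \<gamma>_i)
    qed
  }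
qed

end


theorem theorem4p4:
  fixes A :: "('k::field, 'a::ab_group_add, 'v::ab_group_add) rel_rb"
    and B :: "('k, 'b::ab_group_add, 'm::ab_group_add) rel_rb"
    and E :: "('k, 'e::ab_group_add, 'w::ab_group_add) rel_rb"
    and iB :: "'b \<Rightarrow> 'e" and iM :: "'m \<Rightarrow> 'w"
    and pA :: "'e \<Rightarrow> 'a" and pV :: "'w \<Rightarrow> 'v"
    and sA :: "'a \<Rightarrow> 'e" and sV :: "'v \<Rightarrow> 'w"
    and \<alpha> :: "('a \<Rightarrow> 'a) \<times> ('v \<Rightarrow> 'v)" and \<beta> :: "('b \<Rightarrow> 'b) \<times> ('m \<Rightarrow> 'm)"
    and c :: "('a, 'v, 'b, 'm) sextuple"
  assumes "rel_rota_baxter_lie_algebra A" and "rel_rota_baxter_lie_algebra B"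
    and "non_abelian_extension A B E iB iM pA pV"
    and "is_section A E pA pV sA sV"
    and "c = induced_cocycle A E iB iM sA sV"
    and "\<alpha> \<in> rel_rb_Aut A" and "\<beta> \<in> rel_rb_Aut B"
  shows "inducible E iB iM pA pV sA sV \<alpha> \<beta> \<longleftrightarrow> equivalent_cocycles A B c (twist \<alpha> \<beta> c)"
proof -
  interpret non_abelian_extension A B E iB iM pA pV by (rule assms)
  \<comment> \<open>Both sides say that the twisted cocycle is the cocycle of some section.\<close>
  show ?thesis
    using inducible_iff_splitting[OF assms(4), of "fst \<alpha>" "snd \<alpha>" "fst \<beta>" "snd \<beta>"] assms(5-)
      equivalent_cocycles_iff_splitting[OF assms(4)]
    by simp
qed

end
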